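(* $S_{6,3}(X^2,Y^2)\notin\Theta^2$; that is, the polynomial $S_{6,3}(X^2,Y^2)\in\mathbb{R}\langle X,Y\rangle$ cannot be written as the sum of an element of $\Sigma^2$ and finitely many commutators $pq-qp$ with $p,q\in\mathbb{R}\langle X,Y\rangle$.
   Context: $\langle X,Y\rangle$ is the free monoid of words in two letters $X,Y$ and $\mathbb{R}\langle X,Y\rangle$ is the free associative unital $\mathbb{R}$-algebra on $X,Y$ (polynomials in two noncommuting variables). It carries the involution $p\mapsto p^*$ that is $\mathbb{R}$-linear, satisfies $(pq)^*=q^*p^*$, and fixes $X$ and $Y$ (so $w^*$ is the reverse of a word $w$). Two polynomials $f,g\in\mathbb{R}\langle X,Y\rangle$ are cyclically equivalent if $f-g$ is a finite sum of commutators $pq-qp$ with $p,q\in\mathbb{R}\langle X,Y\rangle$. $\Sigma^2:=\{\sum_i g_i^*g_i\mid g_i\in\mathbb{R}\langle X,Y\rangle\}$ (finite sums) is the cone of sums of hermitian squares, and $\Theta^2$ is the set of all $f\in\mathbb{R}\langle X,Y\rangle$ that are cyclically equivalent to some element of $\Sigma^2$. For integers $m,k$, $S_{m,k}(a,b)$ denotes the sum of all words of length $m$ in $a$ and $b$ in which $b$ appears exactly $k$ times and $a$ exactly $m-k$ times; $S_{m,k}(X^2,Y^2)$ is obtained by taking $a=X^2$, $b=Y^2$. *)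

theory Defs
  imports Complex_Main "HOL-Library.Poly_Mapping"
begin

datatype letter = LX | LY

(* Multiplication of poly_mapping is convolution over an additively written (not necessarily
   commutative) monoid of exponents.  Hence concatenation of words is written "+" and the
   empty word "0". *)

instantiation list :: (type) monoid_add
begin

definition zero_list :: "'a list" where
  "zero_list = []"

definition plus_list :: "'a list \<Rightarrow> 'a list \<Rightarrow> 'a list" where
  "plus_list u v = u @ v"

instance
  by standard (simp_all add: zero_list_def plus_list_def)

end

type_synonym ncpoly = "letter list \<Rightarrow>\<^sub>0 real"

definition monomial :: "letter list \<Rightarrow> ncpoly" where
  "monomial w = Poly_Mapping.single w 1"

definition varX :: ncpoly where
  "varX = monomial [LX]"

definition varY :: ncpoly where
  "varY = monomial [LY]"

(* The scalar r embeds as the constant polynomial, i.e. r times the empty word. *)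

definition scalar :: "real \<Rightarrow> ncpoly" where
  "scalar r = Poly_Mapping.single [] r"

(* The coefficient of w in the adjoint of p is the coefficient of the reverse of w in p. *)

definition adjoint :: "ncpoly \<Rightarrow> ncpoly" where
  "adjoint p = Poly_Mapping.map_key rev p"

lemma lookup_adjoint [simp]:
  "Poly_Mapping.lookup (adjoint p) w = Poly_Mapping.lookup p (rev w)"
  unfolding adjoint_def by (subst map_key.rep_eq) simp_all

lemma adjoint_single:
  "adjoint (Poly_Mapping.single w r) = Poly_Mapping.single (rev w) r"
  by (rule poly_mapping_eqI) (auto simp: lookup_single when_def)

lemma adjoint_varX: "adjoint varX = varX"
  and adjoint_varY: "adjoint varY = varY"
  by (simp_all add: varX_def varY_def monomial_def adjoint_single)

lemma adjoint_zero: "adjoint 0 = 0"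
  by (rule poly_mapping_eqI) simp

lemma adjoint_add: "adjoint (p + q) = adjoint p + adjoint q"
  by (rule poly_mapping_eqI) (simp add: lookup_add)

lemma adjoint_single_mult:
  "adjoint (Poly_Mapping.single u r * Poly_Mapping.single v s) =
     adjoint (Poly_Mapping.single v s) * adjoint (Poly_Mapping.single u r)"
  by (simp add: mult_single adjoint_single plus_list_def mult.commute)

lemma ncpoly_induct [case_names zero add]:
  fixes p :: ncpoly
  assumes "P 0" and "\<And>w r p. P p \<Longrightarrow> P (Poly_Mapping.single w r + p)"
  shows "P p"
proof (induction p rule: update_induct)
  case const
  show ?case by (fact assms(1))
next
  case (update p w r)
  have "Poly_Mapping.update w r p = Poly_Mapping.single w r + p"
    using update(1)
    by (intro poly_mapping_eqI)
      (auto simp: lookup_update lookup_add lookup_single when_def in_keys_iff)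
  with update(3) assms(2) show ?case by simp
qed

lemma adjoint_mult: "adjoint (p * q) = adjoint q * adjoint p"
proof (induction p rule: ncpoly_induct)
  case zero
  show ?case by (simp add: adjoint_zero)
next
  case (add u r p)
  have "adjoint (Poly_Mapping.single u r * q) = adjoint q * adjoint (Poly_Mapping.single u r)"
    by (induction q rule: ncpoly_induct)
      (simp_all add: adjoint_zero adjoint_add distrib_left distrib_right adjoint_single_mult)
  with add show ?case
    by (simp add: adjoint_add distrib_left distrib_right)
qed

lemma adjoint_scalar_mult: "adjoint (scalar r * p) = scalar r * adjoint p"
proof (induction p rule: ncpoly_induct)
  case zero
  show ?case by (simp add: adjoint_zero)
next
  case (add u s p)
  then show ?case
    by (simp add: scalar_def distrib_left adjoint_add adjoint_single mult_single plus_list_def)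
qed

definition cyc_equiv :: "ncpoly \<Rightarrow> ncpoly \<Rightarrow> bool" where
  "cyc_equiv f g \<longleftrightarrow>
     (\<exists>pqs :: (ncpoly \<times> ncpoly) list. f - g = (\<Sum>(p, q)\<leftarrow>pqs. p * q - q * p))"

definition Sigma2 :: "ncpoly set" where
  "Sigma2 = {(\<Sum>g\<leftarrow>gs. adjoint g * g) | gs. True}"

definition Theta2 :: "ncpoly set" where
  "Theta2 = {f. \<exists>s\<in>Sigma2. cyc_equiv f s}"

(* The words are indexed by letter lists, LX standing for a and LY for b; since the index
   set consists of words, equal products of different words are counted separately. *)

definition S_words :: "nat \<Rightarrow> nat \<Rightarrow> 'a::semiring_1 \<Rightarrow> 'a \<Rightarrow> 'a" where
  "S_words m k a b =
     (\<Sum>w | length w = m \<and> count_list w LX = m - k \<and> count_list w LY = k.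
        prod_list (map (case_letter a b) w))"

lemma finite_words: "finite {w :: letter list. length w = m \<and> P w}"
proof -
  have "(UNIV :: letter set) = {LX, LY}"
    using letter.exhaust by auto
  then have "finite (UNIV :: letter set)"
    by (metis finite.emptyI finite_insert)
  then have "finite {w :: letter list. set w \<subseteq> UNIV \<and> length w = m}"
    by (rule finite_lists_length_eq)
  then show ?thesis
    by (rule rev_finite_subset) auto
qed

end

theory Submission
  imports Defs
begin

text \<open>
  Membership in \<open>Theta2\<close> is refuted by separation. A weight \<open>\<phi>\<close> on words extends linearly to a
  functional on polynomials. If \<open>\<phi>\<close> is invariant under cyclic permutation, the functional kills
  commutators, so from \<open>S \<in> Theta2\<close> one gets a single family \<open>gs\<close> such that every tracial
  functional takes the same value on \<open>S\<close> as on the sum of the hermitian squares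
  (\<open>Theta2_traces\<close>). The aim is a tracial weight that is negative on \<open>S\<close> and nonnegative on these
  hermitian squares.

  The weight \<open>obstruction\<close> is \<open>1\<close> on the cyclic classes of \<open>X^6 Y^6\<close> and
  \<open>X^2 Y^2 X^2 Y^2 X^2 Y^2\<close>, is \<open>-1\<close> on those of \<open>X^4 Y^2 X^2 Y^4\<close> and \<open>X^4 Y^4 X^2 Y^2\<close>, and
  vanishes elsewhere. In \<open>S\<close> these four classes have total coefficients 6, 2, 6, 6, so the value
  is \<open>6 + 2 - 6 - 6 = -4\<close>. Cutting a word of one of these classes into two halves that both have
  three letters \<open>X\<close> and three letters \<open>Y\<close> produces very few halves. With \<open>u\<close> and \<open>v\<close> ranging over
  all words of that bidegree, the matrix \<open>obstruction (rev u @ v)\<close> has nonzero entries only at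
  \<open>u, v \<in> {X^3 Y^3, X Y^2 X^2 Y}\<close> and at \<open>u, v \<in> {Y^3 X^3, Y X^2 Y^2 X}\<close>, each time the rank one
  block with rows \<open>(1, -1)\<close> and \<open>(-1, 1)\<close>. Hence, for \<open>g\<close> of bidegree \<open>(3, 3)\<close>, the value on
  \<open>adjoint g * g\<close> is the sum of the squares of two differences of coefficients of \<open>g\<close>.

  It remains to see that the polynomials in \<open>gs\<close> have bidegree \<open>(3, 3)\<close>. This is a leading term
  argument (\<open>weight_le\<close>): the part of extremal degree of the squares cannot cancel, even up to
  commutators, because it is detected by the trace of a suitable pair of symmetric real
  matrices.
\<close>

section \<open>Linear functionals given by a weight on words\<close>

definition functional :: "(letter list \<Rightarrow> real) \<Rightarrow> ncpoly \<Rightarrow> real" where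
  "functional \<phi> p = (\<Sum>w\<in>Poly_Mapping.keys p. Poly_Mapping.lookup p w * \<phi> w)"

lemma functional_superset:
  assumes "finite A" "Poly_Mapping.keys p \<subseteq> A"
  shows "functional \<phi> p = (\<Sum>w\<in>A. Poly_Mapping.lookup p w * \<phi> w)"
  unfolding functional_def
  by (rule sum.mono_neutral_left) (use assms in \<open>auto simp: in_keys_iff\<close>)

lemma functional_zero [simp]: "functional \<phi> 0 = 0"
  by (simp add: functional_def)

lemma functional_add: "functional \<phi> (p + q) = functional \<phi> p + functional \<phi> q"
proof -
  let ?A = "Poly_Mapping.keys p \<union> Poly_Mapping.keys q"
  have "functional \<phi> (p + q) = (\<Sum>w\<in>?A. Poly_Mapping.lookup (p + q) w * \<phi> w)"
    by (rule functional_superset) (simp_all add: Poly_Mapping.keys_add)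
  also have "\<dots> = (\<Sum>w\<in>?A. Poly_Mapping.lookup p w * \<phi> w) + (\<Sum>w\<in>?A. Poly_Mapping.lookup q w * \<phi> w)"
    by (simp add: lookup_add distrib_right sum.distrib)
  also have "\<dots> = functional \<phi> p + functional \<phi> q"
    by (simp add: functional_superset[of ?A])
  finally show ?thesis .
qed

lemma functional_diff: "functional \<phi> (p - q) = functional \<phi> p - functional \<phi> q"
  using functional_add[of \<phi> "p - q" q] by simp

lemma functional_single [simp]: "functional \<phi> (Poly_Mapping.single w r) = r * \<phi> w"
  by (simp add: functional_def)

lemma functional_sum: "functional \<phi> (\<Sum>i\<in>I. h i) = (\<Sum>i\<in>I. functional \<phi> (h i))"
  by (induction I rule: infinite_finite_induct) (simp_all add: functional_add)

lemma functional_sum_list: "functional \<phi> (\<Sum>i\<leftarrow>xs. h i) = (\<Sum>i\<leftarrow>xs. functional \<phi> (h i))"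
  by (induction xs) (simp_all add: functional_add)

lemma functional_mult:
  "functional \<phi> (p * q) = functional (\<lambda>u. functional (\<lambda>v. \<phi> (u @ v)) q) p"
proof (induction p rule: ncpoly_induct)
  case zero
  show ?case by simp
next
  case (add u r p)
  have "functional \<phi> (Poly_Mapping.single u r * q) = r * functional (\<lambda>v. \<phi> (u @ v)) q"
    by (induction q rule: ncpoly_induct)
      (simp_all add: functional_add distrib_left mult_single plus_list_def)
  with add show ?case
    by (simp add: distrib_right functional_add)
qed

lemma functional_adjoint: "functional \<phi> (adjoint p) = functional (\<lambda>w. \<phi> (rev w)) p"
  by (induction p rule: ncpoly_induct)
    (simp_all add: adjoint_zero adjoint_add adjoint_single functional_add)

definition tracial :: "(letter list \<Rightarrow> real) \<Rightarrow> bool" where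
  "tracial \<phi> \<longleftrightarrow> (\<forall>u v. \<phi> (u @ v) = \<phi> (v @ u))"

lemma functional_commutator:
  assumes "tracial \<phi>"
  shows "functional \<phi> (p * q - q * p) = 0"
proof -
  have swap: "\<phi> (u @ v) = \<phi> (v @ u)" for u v
    using assms by (simp add: tracial_def)
  have "functional \<phi> (p * q) =
    (\<Sum>u\<in>Poly_Mapping.keys p. \<Sum>v\<in>Poly_Mapping.keys q.
      Poly_Mapping.lookup p u * (Poly_Mapping.lookup q v * \<phi> (v @ u)))"
    unfolding functional_mult by (simp add: functional_def sum_distrib_left swap[of _ v for v])
  also have "\<dots> = functional \<phi> (q * p)"
    unfolding functional_mult
    by (subst sum.swap) (simp add: functional_def sum_distrib_left mult.left_commute)
  finally show ?thesis
    by (simp add: functional_diff)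
qed

text \<open>
  The family \<open>gs\<close> is chosen before \<open>\<phi>\<close>: one representation is later tested against several
  weights, some of which depend on \<open>gs\<close> itself.
\<close>

lemma Theta2_traces:
  assumes "f \<in> Theta2"
  obtains gs where "\<And>\<phi>. tracial \<phi> \<Longrightarrow>
    functional \<phi> f = (\<Sum>g\<leftarrow>gs. functional \<phi> (adjoint g * g))"
proof -
  obtain gs pqs where f: "f - (\<Sum>g\<leftarrow>gs. adjoint g * g) = (\<Sum>(p, q)\<leftarrow>pqs. p * q - q * p)"
    using assms unfolding Theta2_def Sigma2_def cyc_equiv_def by auto
  have "functional \<phi> f = (\<Sum>g\<leftarrow>gs. functional \<phi> (adjoint g * g))"
    if "tracial \<phi>" for \<phi>
  proof -
    have "functional \<phi> (f - (\<Sum>g\<leftarrow>gs. adjoint g * g)) = 0"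
      unfolding f by (simp add: functional_sum_list split_def functional_commutator[OF that])
    then show ?thesis
      by (simp add: functional_diff functional_sum_list)
  qed
  then show ?thesis using that by blast
qed

text \<open>
  A factorization of the matrix \<open>\<phi> (rev u @ v)\<close> as a sum of rank one matrices turns the value on
  a hermitian square into a sum of squares. The factorization is needed only on the support of
  \<open>g\<close>, which is what makes knowledge of that support useful.
\<close>

lemma functional_hermitian_square:
  assumes "\<And>u v. u \<in> Poly_Mapping.keys g \<Longrightarrow> v \<in> Poly_Mapping.keys g \<Longrightarrow>
    \<phi> (rev u @ v) = (\<Sum>t\<in>T. \<psi> t u * \<psi> t v)"
  shows "functional \<phi> (adjoint g * g) = (\<Sum>t\<in>T. (functional (\<psi> t) g)\<^sup>2)"
proof -
  let ?K = "Poly_Mapping.keys g" and ?c = "Poly_Mapping.lookup g"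
  have "functional \<phi> (adjoint g * g) = (\<Sum>u\<in>?K. \<Sum>v\<in>?K. ?c u * (?c v * \<phi> (rev u @ v)))"
    unfolding functional_mult functional_adjoint by (simp add: functional_def sum_distrib_left)
  also have "\<dots> = (\<Sum>u\<in>?K. \<Sum>v\<in>?K. \<Sum>t\<in>T. (?c u * \<psi> t u) * (?c v * \<psi> t v))"
    by (intro sum.cong refl) (simp add: assms sum_distrib_left mult_ac)
  also have "\<dots> = (\<Sum>u\<in>?K. \<Sum>t\<in>T. \<Sum>v\<in>?K. (?c u * \<psi> t u) * (?c v * \<psi> t v))"
    by (intro sum.cong refl sum.swap)
  also have "\<dots> = (\<Sum>t\<in>T. \<Sum>u\<in>?K. \<Sum>v\<in>?K. (?c u * \<psi> t u) * (?c v * \<psi> t v))"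
    by (rule sum.swap)
  also have "\<dots> = (\<Sum>t\<in>T. (functional (\<psi> t) g)\<^sup>2)"
    by (simp add: functional_def power2_eq_square sum_product)
  finally show ?thesis .
qed

section \<open>Words in squared letters\<close>

definition double :: "letter list \<Rightarrow> letter list" where
  "double w = concat (map (\<lambda>a. [a, a]) w)"

lemma count_list_double: "count_list (double w) a = 2 * count_list w a"
  by (induction w) (auto simp: double_def)

lemma S_words_squares:
  "S_words m k (varX\<^sup>2) (varY\<^sup>2) =
    (\<Sum>w | length w = m \<and> count_list w LX = m - k \<and> count_list w LY = k.
      Poly_Mapping.single (double w) 1)"
proof -
  have "prod_list (map (case_letter (varX\<^sup>2) (varY\<^sup>2)) w) = Poly_Mapping.single (double w) 1" for w
    by (induction w)
      (auto simp: double_def varX_def varY_def monomial_def power2_eq_square mult_single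
        plus_list_def zero_list_def simp flip: single_one split: letter.split)
  then show ?thesis
    by (simp add: S_words_def)
qed

lemma functional_S_words:
  "functional \<phi> (S_words m k (varX\<^sup>2) (varY\<^sup>2)) =
    (\<Sum>w | length w = m \<and> count_list w LX = m - k \<and> count_list w LY = k. \<phi> (double w))"
  by (simp add: S_words_squares functional_sum)

lemma keys_S_words:
  assumes "w \<in> Poly_Mapping.keys (S_words m k (varX\<^sup>2) (varY\<^sup>2))"
  shows "count_list w LX = 2 * (m - k)" "count_list w LY = 2 * k"
proof -
  obtain v where "w = double v" "count_list v LX = m - k" "count_list v LY = k"
    using assms keys_sum unfolding S_words_squares by fastforce
  then show "count_list w LX = 2 * (m - k)" "count_list w LY = 2 * k"
    by (simp_all add: count_list_double)
qed

section \<open>Traces of matrices attached to a path\<close>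

text \<open>
  Label the edge from \<open>i\<close> to \<open>Suc i\<close> of the path \<open>0, ..., length s\<close> with the letter \<open>s ! i\<close>.
  The matrix of a letter is the adjacency matrix of the edges with that label; it is symmetric,
  so the substitution of these matrices for the letters respects the involution.
\<close>

definition path_step :: "letter list \<Rightarrow> letter \<Rightarrow> nat \<Rightarrow> nat \<Rightarrow> real" where
  "path_step s a i j = of_bool ((j = Suc i \<and> s ! i = a) \<or> (i = Suc j \<and> s ! j = a))"

lemma path_step_commute: "path_step s a i j = path_step s a j i"
  by (simp add: path_step_def disj_commute)

text \<open>
  The entries count the walks that read the word along the labels of their edges.
\<close>

fun path_word :: "letter list \<Rightarrow> letter list \<Rightarrow> nat \<Rightarrow> nat \<Rightarrow> real" where
  "path_word s [] i j = of_bool (i = j)"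
| "path_word s (a # w) i j = (\<Sum>k\<le>length s. path_step s a i k * path_word s w k j)"

lemma path_word_append:
  assumes "i \<le> length s"
  shows "path_word s (u @ v) i j = (\<Sum>k\<le>length s. path_word s u i k * path_word s v k j)"
  using assms
proof (induction u arbitrary: i)
  case Nil
  have "(\<Sum>k\<le>length s. path_word s [] i k * path_word s v k j) =
    (\<Sum>k\<le>length s. if i = k then path_word s v k j else 0)"
    by (intro sum.cong) auto
  with Nil show ?case by simp
next
  case (Cons a u)
  have "path_word s ((a # u) @ v) i j =
    (\<Sum>l\<le>length s. \<Sum>k\<le>length s. path_step s a i l * path_word s u l k * path_word s v k j)"
    by (simp add: Cons.IH sum_distrib_left mult.assoc)
  also have "\<dots> = (\<Sum>k\<le>length s. path_word s (a # u) i k * path_word s v k j)"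
    by (subst sum.swap) (simp add: sum_distrib_right)
  finally show ?case .
qed

lemma path_word_rev:
  assumes "i \<le> length s" "j \<le> length s"
  shows "path_word s (rev w) i j = path_word s w j i"
  using assms
proof (induction w arbitrary: i j)
  case Nil
  then show ?case by auto
next
  case (Cons a w)
  have letter: "path_word s [a] k j = path_step s a j k" for k
  proof -
    have "path_word s [a] k j = (\<Sum>l\<le>length s. if l = j then path_step s a k l else 0)"
      unfolding path_word.simps by (intro sum.cong) auto
    then show ?thesis
      using Cons.prems by (simp add: path_step_commute)
  qed
  have "path_word s (rev (a # w)) i j = (\<Sum>k\<le>length s. path_word s (rev w) i k * path_step s a j k)"
    using Cons.prems by (simp only: rev.simps path_word_append letter)
  also have "\<dots> = path_word s (a # w) j i"
    using Cons by (simp add: mult.commute)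
  finally show ?case .
qed

text \<open>
  A walk from \<open>i\<close> to the end of the path in at most \<open>length s - i\<close> steps never turns back. So
  among the words no longer than \<open>s\<close>, only \<open>s\<close> itself has a nonzero entry in the corner
  \<open>(0, length s)\<close>, and this entry reads off the coefficient of \<open>s\<close> in a polynomial.
\<close>

lemma path_word_short:
  assumes "i + length w \<le> length s"
  shows "path_word s w i (length s) = of_bool (w = drop i s)"
  using assms
proof (induction w arbitrary: i)
  case Nil
  then show ?case by auto
next
  case (Cons a w)
  have "path_step s a i k * path_word s w k (length s) =
      (if k = Suc i then of_bool (a # w = drop i s) else 0)" for k
  proof (cases "k = Suc i \<or> i = Suc k")
    case True
    then have "path_word s w k (length s) = of_bool (w = drop k s)"
      using Cons by auto
    moreover have "w \<noteq> drop k s" if "i = Suc k"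
      using that Cons.prems by auto
    moreover have "drop i s = s ! i # drop (Suc i) s"
      using Cons.prems by (intro Cons_nth_drop_Suc[symmetric]) simp
    ultimately show ?thesis
      using True by (auto simp: path_step_def)
  next
    case False
    then show ?thesis by (auto simp: path_step_def)
  qed
  then show ?case
    using Cons.prems by simp
qed

definition trace :: "letter list \<Rightarrow> letter list \<Rightarrow> real" where
  "trace s w = (\<Sum>i\<le>length s. path_word s w i i)"

lemma trace_append: "trace s (u @ v) = (\<Sum>i\<le>length s. \<Sum>k\<le>length s. path_word s u i k * path_word s v k i)"
  by (simp add: trace_def path_word_append)

lemma tracial_trace: "tracial (trace s)"
  unfolding tracial_def trace_append by (subst sum.swap) (simp add: mult.commute)

lemma trace_rev_append:
  "trace s (rev u @ v) =
    (\<Sum>(i, j)\<in>{..length s} \<times> {..length s}. path_word s u i j * path_word s v i j)"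
proof -
  have "trace s (rev u @ v) =
    (\<Sum>j\<le>length s. \<Sum>i\<le>length s. path_word s u i j * path_word s v i j)"
    by (simp add: trace_append path_word_rev)
  then show ?thesis
    by (subst (asm) sum.swap) (simp add: sum.cartesian_product)
qed

section \<open>The support of the squares\<close>

text \<open>
  The leading term argument for a grading \<open>\<omega>\<close>. Let \<open>m\<close> be the largest degree in the family \<open>gs\<close>
  and \<open>s\<close> a longest word of degree \<open>m\<close> in it. The trace of the path matrices of \<open>s\<close>, cut down to
  words of degree \<open>2 * m\<close>, is tracial; on \<open>adjoint g * g\<close> it sees only the part of \<open>g\<close> of degree
  \<open>m\<close> and gives the squared Frobenius norm of the value of this part at the path matrices. One of these
  values is a nonzero matrix, by its corner entry. So \<open>f\<close> has words of degree \<open>2 * m\<close>.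
  A grading may take negative values: with \<open>- \<omega>\<close> in place of \<open>\<omega>\<close> the lemma bounds degrees from
  below.
\<close>

lemma weight_le:
  fixes \<omega> :: "letter list \<Rightarrow> int"
  assumes \<omega>_append: "\<And>u v. \<omega> (u @ v) = \<omega> u + \<omega> v"
    and \<omega>_rev: "\<And>u. \<omega> (rev u) = \<omega> u"
    and f: "\<And>\<phi>. tracial \<phi> \<Longrightarrow>
      functional \<phi> f = (\<Sum>g\<leftarrow>gs. functional \<phi> (adjoint g * g))"
    and \<omega>_f: "\<And>w. w \<in> Poly_Mapping.keys f \<Longrightarrow> \<omega> w = 2 * c"
    and "g \<in> set gs" "w \<in> Poly_Mapping.keys g"
  shows "\<omega> w \<le> c"
proof -
  define K where "K = (\<Union>g\<in>set gs. Poly_Mapping.keys g)"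
  define m where "m = Max (\<omega> ` K)"
  have K: "finite K" "w \<in> K"
    using assms(5,6) by (auto simp: K_def)
  have m_max: "\<omega> u \<le> m" if "u \<in> K" for u
    using that K unfolding m_def by simp
  have "m \<in> \<omega> ` K"
    unfolding m_def using K by (intro Max_in) auto
  let ?L = "{u \<in> K. \<omega> u = m}"
  have "Max (length ` ?L) \<in> length ` ?L"
    using K \<open>m \<in> \<omega> ` K\<close> by (intro Max_in) auto
  then obtain s where s: "s \<in> K" "\<omega> s = m" "length s = Max (length ` ?L)"
    by auto
  then have s_longest: "length u \<le> length s" if "u \<in> K" "\<omega> u = m" for u
    using that K by simp
  obtain h where h: "h \<in> set gs" "s \<in> Poly_Mapping.keys h"
    using s by (auto simp: K_def)
  define \<phi> where "\<phi> u = of_bool (\<omega> u = 2 * m) * trace s u" for u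
  define \<psi> where "\<psi> = (\<lambda>(i, j) u. of_bool (\<omega> u = m) * path_word s u i j)"
  let ?T = "{..length s} \<times> {..length s}"
  have \<phi>_tracial: "tracial \<phi>"
    using tracial_trace[of s] by (simp add: tracial_def \<phi>_def \<omega>_append add.commute)
  have square: "functional \<phi> (adjoint g * g) = (\<Sum>t\<in>?T. (functional (\<psi> t) g)\<^sup>2)"
    if g: "g \<in> set gs" for g
  proof (rule functional_hermitian_square)
    fix u v assume "u \<in> Poly_Mapping.keys g" "v \<in> Poly_Mapping.keys g"
    with g have "u \<in> K" "v \<in> K"
      by (auto simp: K_def)
    then have "\<omega> u \<le> m" "\<omega> v \<le> m"
      using m_max by blast+
    then have "of_bool (\<omega> (rev u @ v) = 2 * m) = (of_bool (\<omega> u = m) * of_bool (\<omega> v = m) :: real)"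
      by (auto simp: \<omega>_append \<omega>_rev)
    then show "\<phi> (rev u @ v) = (\<Sum>t\<in>?T. \<psi> t u * \<psi> t v)"
      by (simp add: \<phi>_def \<psi>_def trace_rev_append sum_distrib_left split_def mult_ac)
  qed
  \<comment> \<open>Words of degree below \<open>m\<close> are killed by \<open>\<psi>\<close>, and those of degree \<open>m\<close> are no longer than
    \<open>s\<close>, so the corner entry singles out \<open>s\<close>.\<close>
  have entry: "functional (\<psi> (0, length s)) h = Poly_Mapping.lookup h s"
  proof -
    have "\<psi> (0, length s) u = of_bool (u = s)" if "u \<in> Poly_Mapping.keys h" for u
    proof (cases "\<omega> u = m")
      case True
      then have "length u \<le> length s"
        using that h by (intro s_longest) (auto simp: K_def)
      then show ?thesis
        using True by (simp add: \<psi>_def path_word_short)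
    next
      case False
      then show ?thesis
        using s by (auto simp: \<psi>_def)
    qed
    then have "functional (\<psi> (0, length s)) h =
      (\<Sum>u\<in>Poly_Mapping.keys h. if u = s then Poly_Mapping.lookup h u else 0)"
      unfolding functional_def by (intro sum.cong) auto
    with h show ?thesis by simp
  qed
  have nonneg: "0 \<le> functional \<phi> (adjoint g * g)" if "g \<in> set gs" for g
    using that by (simp add: square sum_nonneg)
  have "0 < (functional (\<psi> (0, length s)) h)\<^sup>2"
    using h by (simp add: entry in_keys_iff)
  also have "\<dots> \<le> functional \<phi> (adjoint h * h)"
    unfolding square[OF h(1)] by (rule member_le_sum) auto
  also have "\<dots> \<le> functional \<phi> f"
    unfolding f[OF \<phi>_tracial] using h nonneg by (intro member_le_sum_list) auto
  finally have "functional \<phi> f \<noteq> 0"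
    by simp
  then obtain u where "u \<in> Poly_Mapping.keys f" "\<phi> u \<noteq> 0"
    unfolding functional_def by (metis (no_types, lifting) mult_zero_right sum.neutral)
  then have "m = c"
    using \<omega>_f[of u] by (simp add: \<phi>_def)
  with K show ?thesis
    using m_max by auto
qed

section \<open>The obstructing functional\<close>

definition rotations :: "'a list \<Rightarrow> 'a list set" where
  "rotations z = (\<lambda>k. rotate k z) ` {..<length z}"

lemma rotations_append:
  "u @ v \<in> rotations z \<longleftrightarrow> v @ u \<in> rotations z"
proof -
  have "v @ u \<in> rotations z" if uv: "u @ v \<in> rotations z" for u v :: "'a list"
  proof -
    obtain k where k: "u @ v = rotate k z" "k < length z"
      using uv unfolding rotations_def by blast
    have "v @ u = rotate (length u + k) z"
      by (metis k(1) rotate_append rotate_rotate)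
    also have "\<dots> = rotate ((length u + k) mod length z) z"
      by (rule rotate_conv_mod)
    moreover have "(length u + k) mod length z < length z"
      using k(2) by (intro mod_less_divisor) auto
    ultimately show ?thesis
      unfolding rotations_def by (metis imageI lessThan_iff)
  qed
  then show ?thesis by blast
qed

definition obstruction :: "letter list \<Rightarrow> real" where
  "obstruction w =
     of_bool (w \<in> rotations (double [LX,LX,LX,LY,LY,LY]))
   + of_bool (w \<in> rotations (double [LX,LY,LX,LY,LX,LY]))
   - of_bool (w \<in> rotations (double [LX,LX,LY,LX,LY,LY]))
   - of_bool (w \<in> rotations (double [LX,LX,LY,LY,LX,LY]))"

lemma tracial_obstruction: "tracial obstruction"
  unfolding tracial_def obstruction_def
  by (intro allI arg_cong2[where f = "(-)"] arg_cong2[where f = "(+)"] arg_cong[where f = of_bool]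
    rotations_append)

text \<open>
  An explicit list makes the two finite verifications below a matter of rewriting.
\<close>

definition words33 :: "letter list list" where
  "words33 = filter (\<lambda>w. count_list w LX = 3 \<and> count_list w LY = 3) (List.n_lists 6 [LX, LY])"

lemma length_eq_count_letters: "length w = count_list w LX + count_list w LY"
proof (induction w)
  case (Cons a w)
  then show ?case by (cases a) simp_all
qed simp

lemma set_words33: "set words33 = {w. count_list w LX = 3 \<and> count_list w LY = 3}"
proof -
  have "set w \<subseteq> {LX, LY}" for w
    by (metis insertI1 insertI2 letter.exhaust subsetI)
  then show ?thesis
    by (auto simp: words33_def set_n_lists length_eq_count_letters)
qed

lemma obstruction_negative:
  "functional obstruction (S_words 6 3 (varX\<^sup>2) (varY\<^sup>2)) = -4"
proof -
  have "{w. length w = 6 \<and> count_list w LX = 6 - 3 \<and> count_list w LY = 3} = set words33"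
    unfolding set_words33 by (auto simp: length_eq_count_letters)
  moreover have "distinct words33"
    unfolding words33_def by (intro distinct_filter distinct_n_lists) simp
  ultimately have "functional obstruction (S_words 6 3 (varX\<^sup>2) (varY\<^sup>2)) =
      (\<Sum>w\<leftarrow>words33. obstruction (double w))"
    by (simp add: functional_S_words sum_list_distinct_conv_sum_set)
  also have "\<dots> = -4"
    by code_simp
  finally show ?thesis .
qed

text \<open>
  Each pair spans one of the two rank one blocks of the matrix \<open>obstruction (rev u @ v)\<close>.
\<close>

definition gram_pairs :: "(letter list \<times> letter list) list" where
  "gram_pairs =
    [([LX,LX,LX,LY,LY,LY], [LX,LY,LY,LX,LX,LY]), ([LY,LY,LY,LX,LX,LX], [LY,LX,LX,LY,LY,LX])]"

definition pair_weight :: "letter list \<times> letter list \<Rightarrow> letter list \<Rightarrow> real" where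
  "pair_weight t u = of_bool (u = fst t) - of_bool (u = snd t)"

text \<open>
  For instance, with \<open>u = X^3 Y^3\<close> and \<open>v = X Y^2 X^2 Y\<close> the words \<open>rev u @ u\<close>, \<open>rev v @ v\<close> and
  \<open>rev u @ v\<close> are rotations of \<open>X^6 Y^6\<close>, of \<open>X^2 Y^2 X^2 Y^2 X^2 Y^2\<close> and of
  \<open>X^4 Y^2 X^2 Y^4\<close>. The remaining words of bidegree \<open>(3, 3)\<close> contribute nothing, since the
  words obtained from them have a maximal run of odd length in their cyclic order.
\<close>

lemma obstruction_gram:
  assumes "u \<in> set words33" "v \<in> set words33"
  shows "obstruction (rev u @ v) = (\<Sum>t\<in>set gram_pairs. pair_weight t u * pair_weight t v)"
proof -
  have "list_all (\<lambda>u. list_all (\<lambda>v. obstruction (rev u @ v) =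
      (\<Sum>t\<leftarrow>gram_pairs. pair_weight t u * pair_weight t v)) words33) words33"
    by code_simp
  with assms show ?thesis
    by (simp add: list_all_iff gram_pairs_def)
qed

theorem mainTheorem2:
  shows "S_words 6 3 (varX\<^sup>2) (varY\<^sup>2) \<notin> Theta2"
proof
  let ?S = "S_words 6 3 (varX\<^sup>2) (varY\<^sup>2) :: ncpoly"
  assume "?S \<in> Theta2"
  then obtain gs where gs: "\<And>\<phi>. tracial \<phi> \<Longrightarrow>
      functional \<phi> ?S = (\<Sum>g\<leftarrow>gs. functional \<phi> (adjoint g * g))"
    by (rule Theta2_traces) blast
  have "count_list w a = 3" if "g \<in> set gs" "w \<in> Poly_Mapping.keys g" for g w a
  proof -
    have S: "count_list v a = 6" if "v \<in> Poly_Mapping.keys ?S" for v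
      using keys_S_words[OF that] by (cases a) simp_all
    have "\<sigma> * int (count_list w a) \<le> \<sigma> * 3" for \<sigma> :: int
      by (rule weight_le[OF _ _ gs _ that])
        (simp_all add: S distrib_left)
    \<comment> \<open>The gradings by the number of letters \<open>a\<close> and by its negative give the two bounds.\<close>
    from this[of 1] this[of "-1"] show ?thesis
      by simp
  qed
  then have supp: "Poly_Mapping.keys g \<subseteq> set words33" if "g \<in> set gs" for g
    using that by (auto simp: set_words33)
  have "0 \<le> functional obstruction (adjoint g * g)" if "g \<in> set gs" for g
  proof -
    have "functional obstruction (adjoint g * g) =
        (\<Sum>t\<in>set gram_pairs. (functional (pair_weight t) g)\<^sup>2)"
      using supp[OF that] by (intro functional_hermitian_square obstruction_gram) auto
    then show ?thesis
      by (simp add: sum_nonneg)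
  qed
  then have "0 \<le> functional obstruction ?S"
    unfolding gs[OF tracial_obstruction] by (intro sum_list_nonneg) auto
  then show False
    by (simp add: obstruction_negative)
qed

end
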